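(* For every real $q\ge1$ and every real $p>2$, let $f_{q,p}:[0,1]\to\mathbb R$ be given by $$ f_{q,p}(t)=\left[2\left|\frac{2t^p-1}{t^2+(1-t^p)^{\frac2p}}\right|^q+\left(2t(1-t^p)^{\frac1p}\,\frac{t^{p-2}+(1-t^p)^{\frac{p-2}{p}}}{t^2+(1-t^p)^{\frac2p}}\right)^q\right]^{\frac1q}. $$ Then $$ K_{2,q,p}=\max\{f_{q,p}(t):\ t\in[0,1]\}. $$
   Context: $\mathcal P(^2\mathbb R^2)$ is the real vector space of $2$-homogeneous polynomials $P(x,y)=ax^2+bxy+cy^2$ with $a,b,c\in\mathbb R$. For $1\le q<\infty$, $|P|_q=(|a|^q+|b|^q+|c|^q)^{1/q}$. For $1\le p<\infty$, $\|P\|_p=\sup\{|P(x,y)|:\ |x|^p+|y|^p\le 1\}$. The constant $K_{2,q,p}$ is the smallest $K>0$ such that $|P|_q\le K\|P\|_p$ for all $P\in\mathcal P(^2\mathbb R^2)$. *)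

theory Defs
  imports Complex_Main
begin

text \<open>The polynomial \<open>a x\<^sup>2 + b x y + c y\<^sup>2\<close> of \<open>\<P>(\<^sup>2\<real>\<^sup>2)\<close> is represented by its coefficients
  \<open>(a, b, c)\<close>, which it determines uniquely.\<close>

type_synonym hpoly2 = "real \<times> real \<times> real"

definition eval2 :: "hpoly2 \<Rightarrow> real \<Rightarrow> real \<Rightarrow> real" where
  "eval2 P x y = (case P of (a, b, c) \<Rightarrow> a * x^2 + b * x * y + c * y^2)"

definition coeff_norm :: "real \<Rightarrow> hpoly2 \<Rightarrow> real" where
  "coeff_norm q P =
     (case P of (a, b, c) \<Rightarrow> (\<bar>a\<bar> powr q + \<bar>b\<bar> powr q + \<bar>c\<bar> powr q) powr (1 / q))"

definition lp_disc :: "real \<Rightarrow> (real \<times> real) set" where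
  "lp_disc p = {(x, y). \<bar>x\<bar> powr p + \<bar>y\<bar> powr p \<le> 1}"

definition poly_norm :: "real \<Rightarrow> hpoly2 \<Rightarrow> real" where
  "poly_norm p P = (SUP (x, y) \<in> lp_disc p. \<bar>eval2 P x y\<bar>)"

definition K2 :: "real \<Rightarrow> real \<Rightarrow> real" where
  "K2 q p = (LEAST K. K > 0 \<and> (\<forall>P. coeff_norm q P \<le> K * poly_norm p P))"

text \<open>Only evaluated for \<open>p > 2\<close> and \<open>0 \<le> t \<le> 1\<close>: all bases of \<open>powr\<close> are then nonnegative and
  all exponents positive, so \<open>powr\<close> is the usual real power, also at base \<open>0\<close>.\<close>

definition f_qp :: "real \<Rightarrow> real \<Rightarrow> real \<Rightarrow> real" where
  "f_qp q p t =
     (2 * \<bar>(2 * t powr p - 1) / (t^2 + (1 - t powr p) powr (2 / p))\<bar> powr q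
      + (2 * t * (1 - t powr p) powr (1 / p)
         * ((t powr (p - 2) + (1 - t powr p) powr ((p - 2) / p))
            / (t^2 + (1 - t powr p) powr (2 / p)))) powr q) powr (1 / q)"

end

theory Submission
  imports Defs "HOL-Analysis.Convex"
begin

text \<open>
  For \<open>t \<in> [0,1]\<close> let \<open>s \<ge> 0\<close> be such that \<open>t\<^sup>p + s\<^sup>p = 1\<close>. The number \<open>f_qp q p t\<close> is the
  coefficient norm of the polynomial \<open>A x\<^sup>2 + B x y - A y\<^sup>2\<close> with
  \<open>A = (t\<^sup>p - s\<^sup>p) / (t\<^sup>2 + s\<^sup>2)\<close> and \<open>B = 2 t s (t\<^bsup>p-2\<^esup> + s\<^bsup>p-2\<^esup>) / (t\<^sup>2 + s\<^sup>2)\<close>,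
  which takes the value 1 at \<open>(t, s)\<close>. The theorem says that this curve of polynomials
  lies in the unit ball of \<open>poly_norm p\<close> and that the largest coefficient norm on the ball
  is found on it.

  The curve lies in the ball because of the identity
  \<open>(t\<^sup>2 + s\<^sup>2) (A x\<^sup>2 + B x y - A y\<^sup>2)
    = (t\<^sup>2 + s\<^sup>2) (t\<^bsup>p-2\<^esup> x\<^sup>2 + s\<^bsup>p-2\<^esup> y\<^sup>2) - (t\<^bsup>p-2\<^esup> + s\<^bsup>p-2\<^esup>) (t y - s x)\<^sup>2\<close>,
  in which \<open>t\<^bsup>p-2\<^esup> x\<^sup>2 + s\<^bsup>p-2\<^esup> y\<^sup>2\<close> is at most 1 on the \<open>\<ell>\<^sub>p\<close> disc by Young's inequality
  (\<open>extremal_le_one\<close>). The lower bound \<open>-1\<close> is then free, because a polynomial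
  \<open>(a, b, -a)\<close> changes sign under the rotation \<open>(x, y) \<mapsto> (y, -x)\<close>, an isometry of the disc
  (\<open>poly_norm_antisymmetric_le\<close>).

  For the converse let \<open>(a, b, c)\<close> be in the ball. Exchanging the variables and changing
  signs gives \<open>\<bar>c\<bar> \<le> a\<close> and \<open>b \<ge> 0\<close>. Replacing \<open>c\<close> by \<open>-a\<close> does not decrease the
  coefficient norm, and keeps the polynomial in the ball: where \<open>x y \<ge> 0\<close> the new
  polynomial is below the old one, and where \<open>x y \<le> 0\<close> it is at most \<open>a x\<^sup>2 \<le> 1\<close>; the
  rotation gives the lower bound again (\<open>poly_norm_antisymmetrize_le\<close>). Hence only polynomials
  \<open>(a, b, -a)\<close> with \<open>a, b \<ge> 0\<close> matter. As \<open>t\<close> runs through \<open>[0,1]\<close>, \<open>A\<close> runs continuously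
  from \<open>-1\<close> to \<open>1\<close>, so \<open>A = a\<close> for some \<open>t\<close>; comparing values at \<open>(t, s)\<close>, where the
  polynomial of the curve reaches 1, gives \<open>b \<le> B\<close> (\<open>antisymmetric_dominated\<close>). At \<open>t = 1\<close>
  this comparison is void, and \<open>b \<le> 0\<close> comes from points of the disc near \<open>(1, 0)\<close>.
\<close>

section \<open>The norm on polynomials\<close>

lemma abs_le_one_of_lp_disc:
  fixes p x y :: real
  assumes "p > 0" "\<bar>x\<bar> powr p + \<bar>y\<bar> powr p \<le> 1"
  shows "\<bar>x\<bar> \<le> 1" "\<bar>y\<bar> \<le> 1"
proof -
  have *: "\<bar>z\<bar> \<le> 1" if "\<bar>z\<bar> powr p \<le> 1" for z :: real
  proof (rule ccontr)
    assume "\<not> \<bar>z\<bar> \<le> 1"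
    then have "\<bar>z\<bar> powr p > 1 powr p"
      using assms(1) by (intro powr_less_mono2) auto
    with that show False by simp
  qed
  have "\<bar>x\<bar> powr p \<ge> 0" "\<bar>y\<bar> powr p \<ge> 0" by auto
  with assms(2) have "\<bar>x\<bar> powr p \<le> 1" "\<bar>y\<bar> powr p \<le> 1" by linarith+
  then show "\<bar>x\<bar> \<le> 1" "\<bar>y\<bar> \<le> 1" by (auto intro: *)
qed

lemma eval2_bounded:
  assumes "p > 0"
  shows "bdd_above ((\<lambda>(x, y). \<bar>eval2 P x y\<bar>) ` lp_disc p)"
proof -
  obtain a b c where P: "P = (a, b, c)" by (cases P)
  have "\<bar>eval2 P x y\<bar> \<le> \<bar>a\<bar> + \<bar>b\<bar> + \<bar>c\<bar>" if "(x, y) \<in> lp_disc p" for x y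
  proof -
    have xy: "\<bar>x\<bar> \<le> 1" "\<bar>y\<bar> \<le> 1"
      using abs_le_one_of_lp_disc[OF assms] that by (auto simp: lp_disc_def)
    have "\<bar>a * x\<^sup>2\<bar> \<le> \<bar>a\<bar>" "\<bar>c * y\<^sup>2\<bar> \<le> \<bar>c\<bar>"
      using xy by (auto simp: abs_mult abs_square_le_1 intro!: mult_left_le)
    moreover have "\<bar>b * x * y\<bar> \<le> \<bar>b\<bar>"
      using xy by (auto simp: abs_mult mult.assoc intro!: mult_left_le mult_le_one)
    ultimately show ?thesis unfolding P eval2_def prod.case by linarith
  qed
  then show ?thesis by (intro bdd_aboveI[of _ "\<bar>a\<bar> + \<bar>b\<bar> + \<bar>c\<bar>"]) auto
qed

lemma poly_norm_le_iff:
  assumes "p > 0"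
  shows "poly_norm p P \<le> N \<longleftrightarrow>
    (\<forall>x y. \<bar>x\<bar> powr p + \<bar>y\<bar> powr p \<le> 1 \<longrightarrow> \<bar>eval2 P x y\<bar> \<le> N)"
proof -
  have "(0, 0) \<in> lp_disc p" by (simp add: lp_disc_def)
  then have "lp_disc p \<noteq> {}" by blast
  then have "poly_norm p P \<le> N \<longleftrightarrow> (\<forall>z\<in>lp_disc p. (\<lambda>(x, y). \<bar>eval2 P x y\<bar>) z \<le> N)"
    unfolding poly_norm_def by (intro cSUP_le_iff eval2_bounded assms)
  then show ?thesis by (auto simp: lp_disc_def)
qed

lemma poly_norm_swap_le:
  assumes "p > 0" "poly_norm p (a, b, c) \<le> N"
  shows "poly_norm p (c, b, a) \<le> N"
  unfolding poly_norm_le_iff[OF assms(1)]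
proof (intro allI impI)
  fix x y :: real
  assume "\<bar>x\<bar> powr p + \<bar>y\<bar> powr p \<le> 1"
  then have "\<bar>eval2 (a, b, c) y x\<bar> \<le> N"
    using assms by (auto simp: poly_norm_le_iff add.commute)
  then show "\<bar>eval2 (c, b, a) x y\<bar> \<le> N"
    by (simp add: eval2_def algebra_simps)
qed

lemma poly_norm_minus_le:
  assumes "p > 0" "poly_norm p (a, b, c) \<le> N"
  shows "poly_norm p (- a, - b, - c) \<le> N"
proof -
  have "eval2 (- a, - b, - c) x y = - eval2 (a, b, c) x y" for x y
    by (simp add: eval2_def)
  then show ?thesis using assms by (simp add: poly_norm_le_iff)
qed

lemma poly_norm_reflect_le:
  assumes "p > 0" "poly_norm p (a, b, c) \<le> N"
  shows "poly_norm p (a, - b, c) \<le> N"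
  unfolding poly_norm_le_iff[OF assms(1)]
proof (intro allI impI)
  fix x y :: real
  assume "\<bar>x\<bar> powr p + \<bar>y\<bar> powr p \<le> 1"
  then have "\<bar>eval2 (a, b, c) x (- y)\<bar> \<le> N"
    using assms by (auto simp: poly_norm_le_iff)
  then show "\<bar>eval2 (a, - b, c) x y\<bar> \<le> N"
    by (simp add: eval2_def)
qed

lemma poly_norm_scale_le:
  assumes "p > 0" "N > 0" "poly_norm p (a, b, c) \<le> N"
  shows "poly_norm p (a / N, b / N, c / N) \<le> 1"
proof -
  have "eval2 (a / N, b / N, c / N) x y = eval2 (a, b, c) x y / N" for x y
    by (simp add: eval2_def add_divide_distrib)
  then show ?thesis using assms by (simp add: poly_norm_le_iff)
qed

lemma coeff_norm_scale:
  assumes "q > 0" "N > 0"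
  shows "coeff_norm q (a / N, b / N, c / N) = coeff_norm q (a, b, c) / N"
proof -
  have "\<bar>a / N\<bar> powr q + \<bar>b / N\<bar> powr q + \<bar>c / N\<bar> powr q
      = (\<bar>a\<bar> powr q + \<bar>b\<bar> powr q + \<bar>c\<bar> powr q) / N powr q"
    using assms by (simp add: powr_divide add_divide_distrib abs_divide)
  then show ?thesis
    using assms by (simp add: coeff_norm_def powr_divide powr_powr)
qed

lemma coeff_norm_mono:
  assumes "q > 0" "\<bar>a\<bar> \<le> \<bar>a'\<bar>" "\<bar>b\<bar> \<le> \<bar>b'\<bar>" "\<bar>c\<bar> \<le> \<bar>c'\<bar>"
  shows "coeff_norm q (a, b, c) \<le> coeff_norm q (a', b', c')"
  unfolding coeff_norm_def prod.case using assms
  by (intro powr_mono2 add_mono) auto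

section \<open>Reduction to polynomials that are odd under a quarter turn\<close>

text \<open>The rotation \<open>(x, y) \<mapsto> (y, -x)\<close> preserves the disc and changes the sign of
  \<open>a x\<^sup>2 + b x y - a y\<^sup>2\<close>, so a one-sided bound is a bound on the absolute value.\<close>

lemma poly_norm_antisymmetric_le:
  assumes "p > 0"
    and "\<And>x y. \<bar>x\<bar> powr p + \<bar>y\<bar> powr p \<le> 1 \<Longrightarrow> eval2 (a, b, - a) x y \<le> N"
  shows "poly_norm p (a, b, - a) \<le> N"
  unfolding poly_norm_le_iff[OF assms(1)]
proof (intro allI impI)
  fix x y :: real
  assume *: "\<bar>x\<bar> powr p + \<bar>y\<bar> powr p \<le> 1"
  have "eval2 (a, b, - a) x y \<le> N" using assms(2) * .
  moreover have "eval2 (a, b, - a) y (- x) \<le> N"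
    using * by (intro assms(2)) (simp add: add.commute)
  then have "- eval2 (a, b, - a) x y \<le> N"
    by (simp add: eval2_def algebra_simps)
  ultimately show "\<bar>eval2 (a, b, - a) x y\<bar> \<le> N" by linarith
qed

text \<open>By the previous lemma only an upper bound is needed. Where \<open>x y \<ge> 0\<close> it is inherited
  from the original polynomial, because \<open>-a \<le> c\<close>. Where \<open>x y \<le> 0\<close> the only term of \<open>a x\<^sup>2 + b x y - a y\<^sup>2\<close> that can be positive is \<open>a x\<^sup>2\<close>, and \<open>a\<close> is the value of
  the original polynomial at \<open>(1, 0)\<close>.\<close>

lemma poly_norm_antisymmetrize_normalized_le:
  assumes "p > 0" "poly_norm p (a, b, c) \<le> N" "\<bar>c\<bar> \<le> a" "b \<ge> 0"
  shows "poly_norm p (a, b, - a) \<le> N"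
proof (rule poly_norm_antisymmetric_le[OF assms(1)])
  fix x y :: real
  assume xy: "\<bar>x\<bar> powr p + \<bar>y\<bar> powr p \<le> 1"
  have P: "\<bar>eval2 (a, b, c) u v\<bar> \<le> N" if "\<bar>u\<bar> powr p + \<bar>v\<bar> powr p \<le> 1" for u v
    using assms(1,2) that by (simp add: poly_norm_le_iff)
  show "eval2 (a, b, - a) x y \<le> N"
  proof (cases "x * y \<ge> 0")
    case True
    have "- a * y\<^sup>2 \<le> c * y\<^sup>2"
      using assms(3) by (intro mult_right_mono) auto
    then have "eval2 (a, b, - a) x y \<le> eval2 (a, b, c) x y"
      by (simp add: eval2_def)
    also have "\<dots> \<le> N" using P[OF xy] by linarith
    finally show ?thesis .
  next
    case False
    have "b * (x * y) \<le> 0"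
      using assms(4) False by (simp add: mult_nonneg_nonpos)
    moreover have "a * y\<^sup>2 \<ge> 0" using assms(3) by auto
    moreover have "a * x\<^sup>2 \<le> a"
      using assms(3) abs_le_one_of_lp_disc[OF assms(1) xy]
      by (intro mult_left_le) (auto simp: abs_square_le_1)
    moreover have "a \<le> N" using P[of 1 0] by (simp add: eval2_def)
    ultimately show ?thesis by (simp add: eval2_def mult.assoc)
  qed
qed

text \<open>The symmetries of the disc reduce an arbitrary polynomial to the signs and the order
  of the coefficients in the previous lemma.\<close>

lemma poly_norm_antisymmetrize_le:
  assumes "p > 0" "poly_norm p (a, b, c) \<le> N"
  defines "m \<equiv> max \<bar>a\<bar> \<bar>c\<bar>"
  shows "poly_norm p (m, \<bar>b\<bar>, - m) \<le> N"
proof -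
  have *: "poly_norm p (\<bar>a\<bar>, \<bar>b\<bar>, - \<bar>a\<bar>) \<le> N"
    if P: "poly_norm p (a, b, c) \<le> N" and "\<bar>c\<bar> \<le> \<bar>a\<bar>" for a b c :: real
  proof -
    obtain b' c' where 1: "poly_norm p (\<bar>a\<bar>, b', c') \<le> N" "\<bar>b'\<bar> = \<bar>b\<bar>" "\<bar>c'\<bar> = \<bar>c\<bar>"
    proof (cases "a \<ge> 0")
      case True
      then show ?thesis using that[of b c] P by simp
    next
      case False
      then show ?thesis
        using that[of "- b" "- c"] poly_norm_minus_le[OF assms(1) P] by simp
    qed
    have "poly_norm p (\<bar>a\<bar>, \<bar>b'\<bar>, c') \<le> N"
      using 1(1) poly_norm_reflect_le[OF assms(1) 1(1)] by (cases "b' \<ge> 0") auto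
    then show ?thesis
      using 1 \<open>\<bar>c\<bar> \<le> \<bar>a\<bar>\<close>
        poly_norm_antisymmetrize_normalized_le[OF assms(1), of "\<bar>a\<bar>" "\<bar>b'\<bar>" c' N] by simp
  qed
  show ?thesis
  proof (cases "\<bar>c\<bar> \<le> \<bar>a\<bar>")
    case True
    then show ?thesis using *[OF assms(2)] by (simp add: m_def)
  next
    case False
    then show ?thesis
      using *[OF poly_norm_swap_le[OF assms(1,2)]] by (simp add: m_def max_def)
  qed
qed

section \<open>The extremal curve\<close>

definition diag_coeff :: "real \<Rightarrow> real \<Rightarrow> real \<Rightarrow> real" where
  "diag_coeff p t s = (t powr p - s powr p) / (t\<^sup>2 + s\<^sup>2)"

definition mixed_coeff :: "real \<Rightarrow> real \<Rightarrow> real \<Rightarrow> real" where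
  "mixed_coeff p t s = 2 * t * s * ((t powr (p - 2) + s powr (p - 2)) / (t\<^sup>2 + s\<^sup>2))"

definition extremal_poly :: "real \<Rightarrow> real \<Rightarrow> real \<Rightarrow> hpoly2" where
  "extremal_poly p t s = (diag_coeff p t s, mixed_coeff p t s, - diag_coeff p t s)"

definition lp_cofactor :: "real \<Rightarrow> real \<Rightarrow> real" where
  "lp_cofactor p t = (1 - t powr p) powr (1 / p)"

lemma powr_minus_2_mult_square:
  fixes t p :: real
  assumes "t \<ge> 0"
  shows "t powr (p - 2) * t\<^sup>2 = t powr p"
proof (cases "t = 0")
  case False
  then have "t powr (p - 2) * t powr 2 = t powr p"
    by (simp flip: powr_add)
  then show ?thesis using assms False by simp
qed simp

lemma powr_eq_square_powr:
  fixes x p :: real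
  shows "\<bar>x\<bar> powr p = (x\<^sup>2) powr (p / 2)"
proof (cases "x = 0")
  case False
  then have "x\<^sup>2 = \<bar>x\<bar> powr 2" by simp
  then show ?thesis by (simp only: powr_powr) simp
qed simp

text \<open>Young's inequality with the conjugate exponents \<open>p / (p - 2)\<close> and \<open>p / 2\<close>.\<close>

lemma powr_mult_square_le:
  fixes t x p :: real
  assumes "p > 2"
  shows "t powr (p - 2) * x\<^sup>2 \<le> (p - 2) / p * t powr p + 2 / p * \<bar>x\<bar> powr p"
proof -
  have "t powr (p - 2) * x\<^sup>2
      \<le> (t powr (p - 2)) powr (p / (p - 2)) / (p / (p - 2)) + (x\<^sup>2) powr (p / 2) / (p / 2)"
    using assms by (intro Youngs_inequality) (auto simp: field_simps)
  also have "(t powr (p - 2)) powr (p / (p - 2)) = t powr p"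
    using assms by (simp add: powr_powr)
  finally show ?thesis using assms by (simp add: powr_eq_square_powr mult.commute)
qed

lemma sum_squares_pos_of_powr:
  fixes t s p :: real
  assumes "t powr p + s powr p = 1"
  shows "t\<^sup>2 + s\<^sup>2 > 0"
  using assms by (cases "t = 0") (auto simp: sum_power2_gt_zero_iff)

lemma eval2_extremal_poly:
  "eval2 (extremal_poly p t s) x y
    = ((t powr p - s powr p) * (x\<^sup>2 - y\<^sup>2)
        + 2 * t * s * (t powr (p - 2) + s powr (p - 2)) * x * y) / (t\<^sup>2 + s\<^sup>2)"
  by (simp add: eval2_def extremal_poly_def diag_coeff_def mixed_coeff_def
      divide_inverse algebra_simps)

text \<open>Write \<open>T = t\<^bsup>p-2\<^esup>\<close> and \<open>S = s\<^bsup>p-2\<^esup>\<close>. The polynomial of the curve, multiplied by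
  \<open>t\<^sup>2 + s\<^sup>2\<close>, equals \<open>(t\<^sup>2 + s\<^sup>2) (T x\<^sup>2 + S y\<^sup>2)\<close> minus a positive multiple of the square of \<open>t y - s x\<close>, which vanishes exactly in the direction of the
  contact point \<open>(t, s)\<close>. Young's inequality bounds the diagonal form \<open>T x\<^sup>2 + S y\<^sup>2\<close>, with
  equality at the same point.\<close>

lemma extremal_le_one:
  assumes "p > 2" "t \<ge> 0" "s \<ge> 0" "t powr p + s powr p = 1"
    and "\<bar>x\<bar> powr p + \<bar>y\<bar> powr p \<le> 1"
  shows "eval2 (extremal_poly p t s) x y \<le> 1"
proof -
  define T S where "T = t powr (p - 2)" and "S = s powr (p - 2)"
  have TS: "T \<ge> 0" "S \<ge> 0" "t powr p = T * t\<^sup>2" "s powr p = S * s\<^sup>2"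
    using assms by (auto simp: T_def S_def powr_minus_2_mult_square)
  have D: "t\<^sup>2 + s\<^sup>2 > 0" using assms by (intro sum_squares_pos_of_powr)
  have "T * x\<^sup>2 + S * y\<^sup>2
      \<le> (p - 2) / p * (t powr p + s powr p) + 2 / p * (\<bar>x\<bar> powr p + \<bar>y\<bar> powr p)"
    using powr_mult_square_le[OF assms(1), of t x] powr_mult_square_le[OF assms(1), of s y]
    unfolding T_def S_def distrib_left by linarith
  also have "\<dots> \<le> (p - 2) / p * 1 + 2 / p * 1"
    using assms by (intro add_mono mult_left_mono) auto
  also have "\<dots> = 1" using assms by (simp add: field_simps)
  finally have Y: "T * x\<^sup>2 + S * y\<^sup>2 \<le> 1" .
  have "eval2 (extremal_poly p t s) x y * (t\<^sup>2 + s\<^sup>2)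
      = (T * t\<^sup>2 - S * s\<^sup>2) * (x\<^sup>2 - y\<^sup>2) + 2 * t * s * (T + S) * x * y"
    using D by (simp add: eval2_extremal_poly T_def[symmetric] S_def[symmetric] TS)
  also have "\<dots> = (t\<^sup>2 + s\<^sup>2) * (T * x\<^sup>2 + S * y\<^sup>2) - (T + S) * (t * y - s * x)\<^sup>2"
    by algebra
  also have "\<dots> \<le> (t\<^sup>2 + s\<^sup>2) * (T * x\<^sup>2 + S * y\<^sup>2)"
    using TS by simp
  also have "\<dots> \<le> (t\<^sup>2 + s\<^sup>2) * 1"
    using D Y by (intro mult_left_mono) auto
  finally show ?thesis using D by simp
qed

lemma extremal_eq_one:
  assumes "t \<ge> 0" "s \<ge> 0" "t powr p + s powr p = 1"
  shows "eval2 (extremal_poly p t s) t s = 1"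
proof -
  define T S where "T = t powr (p - 2)" and "S = s powr (p - 2)"
  have TS: "t powr p = T * t\<^sup>2" "s powr p = S * s\<^sup>2"
    using assms by (auto simp: T_def S_def powr_minus_2_mult_square)
  have D: "t\<^sup>2 + s\<^sup>2 > 0" using assms by (intro sum_squares_pos_of_powr)
  have "eval2 (extremal_poly p t s) t s * (t\<^sup>2 + s\<^sup>2)
      = (T * t\<^sup>2 - S * s\<^sup>2) * (t\<^sup>2 - s\<^sup>2) + 2 * t * s * (T + S) * t * s"
    using D by (simp add: eval2_extremal_poly T_def[symmetric] S_def[symmetric] TS)
  also have "\<dots> = (t\<^sup>2 + s\<^sup>2) * (T * t\<^sup>2 + S * s\<^sup>2)" by algebra
  also have "\<dots> = 1 * (t\<^sup>2 + s\<^sup>2)" using assms TS by simp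
  finally show ?thesis using D by (metis less_irrefl mult_right_cancel)
qed

lemma poly_norm_extremal_le:
  assumes "p > 2" "t \<ge> 0" "s \<ge> 0" "t powr p + s powr p = 1"
  shows "poly_norm p (extremal_poly p t s) \<le> 1"
  using assms extremal_le_one[OF assms]
  unfolding extremal_poly_def by (intro poly_norm_antisymmetric_le) auto

lemma lp_cofactor:
  assumes "p > 0" "0 \<le> t" "t \<le> 1"
  shows "lp_cofactor p t \<ge> 0" "t powr p + lp_cofactor p t powr p = 1"
proof -
  have "t powr p \<le> 1 powr p" using assms by (intro powr_mono2) auto
  then show "t powr p + lp_cofactor p t powr p = 1"
    using assms by (simp add: lp_cofactor_def powr_powr)
qed (simp add: lp_cofactor_def)

lemma f_qp_eq_coeff_norm:
  assumes "p > 2" "0 \<le> t" "t \<le> 1"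
  shows "f_qp q p t = coeff_norm q (extremal_poly p t (lp_cofactor p t))"
proof -
  define s where "s = lp_cofactor p t"
  have s: "s \<ge> 0" "t powr p + s powr p = 1"
    using lp_cofactor[of p t] assms by (auto simp: s_def)
  have 1: "(1 - t powr p) powr (2 / p) = s\<^sup>2"
    by (simp add: s_def lp_cofactor_def power2_eq_square flip: powr_add)
  have 2: "(1 - t powr p) powr ((p - 2) / p) = s powr (p - 2)"
    by (simp add: s_def lp_cofactor_def powr_powr)
  have "mixed_coeff p t s \<ge> 0"
    using assms s by (auto simp: mixed_coeff_def)
  then have 3: "\<bar>mixed_coeff p t s\<bar> = mixed_coeff p t s" by simp
  have 4: "2 * t powr p - 1 = t powr p - s powr p" using s by simp
  show ?thesis
    unfolding f_qp_def coeff_norm_def extremal_poly_def prod.case s_def[symmetric]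
      1 2 3 4 abs_minus_cancel lp_cofactor_def[symmetric]
    by (simp add: diag_coeff_def mixed_coeff_def)
qed

lemma continuous_on_lp_cofactor:
  assumes "p > 0"
  shows "continuous_on {0..1} (lp_cofactor p)"
proof -
  have "t powr p \<le> 1" if "0 \<le> t" "t \<le> 1" for t :: real
    using powr_mono2[of p t 1] that assms by simp
  then show ?thesis
    unfolding lp_cofactor_def using assms
    by (intro continuous_on_powr' continuous_intros) auto
qed

lemma continuous_on_coeffs:
  assumes "p > 2"
  shows "continuous_on {0..1} (\<lambda>t. diag_coeff p t (lp_cofactor p t))"
    and "continuous_on {0..1} (\<lambda>t. mixed_coeff p t (lp_cofactor p t))"
proof -
  have c: "continuous_on {0..1} (lp_cofactor p)"
    using assms by (intro continuous_on_lp_cofactor) auto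
  have s: "lp_cofactor p t \<ge> 0" "t\<^sup>2 + (lp_cofactor p t)\<^sup>2 \<noteq> 0" if "t \<in> {0..1}" for t
    using lp_cofactor[of p t] sum_squares_pos_of_powr[of t p "lp_cofactor p t"] assms that
    by auto
  show "continuous_on {0..1} (\<lambda>t. diag_coeff p t (lp_cofactor p t))"
    unfolding diag_coeff_def using assms s
    by (intro continuous_on_divide continuous_on_diff continuous_on_powr'
        continuous_intros c ballI) auto
  show "continuous_on {0..1} (\<lambda>t. mixed_coeff p t (lp_cofactor p t))"
    unfolding mixed_coeff_def using assms s
    by (intro continuous_on_mult continuous_on_divide continuous_on_add continuous_on_powr'
        continuous_intros c ballI) auto
qed

lemma f_qp_attains_max:
  assumes "q > 0" "p > 2"
  shows "\<exists>t\<^sub>0\<in>{0..1}. \<forall>t\<in>{0..1}. f_qp q p t \<le> f_qp q p t\<^sub>0"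
proof -
  have "continuous_on {0..1} (\<lambda>t. coeff_norm q (extremal_poly p t (lp_cofactor p t)))"
    unfolding coeff_norm_def extremal_poly_def prod.case
    using assms
    by (intro continuous_on_powr' continuous_on_add continuous_on_rabs continuous_on_minus
        continuous_on_coeffs continuous_on_const ballI) (auto intro!: add_nonneg_nonneg)
  then have "continuous_on {0..1} (f_qp q p)"
    using assms by (subst continuous_on_cong[OF refl f_qp_eq_coeff_norm]) auto
  then show ?thesis by (intro continuous_attains_sup) auto
qed

section \<open>Domination by the extremal curve\<close>

text \<open>The endpoint \<open>t = 1\<close> of the curve, where the value at \<open>(t, s) = (1, 0)\<close> carries no
  information about the mixed coefficient. On the boundary of the disc near \<open>(1, 0)\<close> the
  number \<open>1 - x\<^sup>2\<close> is only of order \<open>y\<^sup>p\<close>, so for \<open>b > 0\<close> the linear term \<open>b x y\<close>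
  would push the value \<open>x\<^sup>2 + b x y - y\<^sup>2\<close> above 1.\<close>

lemma mixed_coeff_nonpos_of_diag_one:
  assumes "p > 2" "poly_norm p (1, b, - 1) \<le> 1"
  shows "b \<le> 0"
proof (rule ccontr)
  assume "\<not> b \<le> 0"
  then have b: "b > 0" by simp
  \<comment> \<open>The norm bound forces \<open>b (1 - y) \<le> 2 y\<close> for every \<open>y\<close> strictly between 0 and 1;
    it fails as soon as \<open>y < b / (b + 2)\<close>.\<close>
  define y where "y = b / (b + 3)"
  define x where "x = lp_cofactor p y"
  have y: "0 < y" "y < 1" using b by (auto simp: y_def)
  have x: "x \<ge> 0" "y powr p + x powr p = 1"
    using lp_cofactor[of p y] assms(1) y by (auto simp: x_def)
  have x1: "x \<le> 1"
    using abs_le_one_of_lp_disc(2)[of p y x] assms(1) x y by simp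
  have "x powr p \<le> x powr 2" if "x > 0"
    using that x1 assms(1) by (intro powr_mono') auto
  then have xp2: "x powr p \<le> x\<^sup>2" using x by (cases "x = 0") auto
  have "y powr p \<le> y powr 2" using y assms(1) by (intro powr_mono') auto
  then have yp2: "y powr p \<le> y\<^sup>2" using y by simp
  have "y\<^sup>2 \<le> y" using y by (simp add: power2_eq_square mult_left_le)
  moreover have "x\<^sup>2 \<le> x" using x x1 by (simp add: power2_eq_square mult_left_le)
  ultimately have x_ge: "1 - y \<le> x" using xp2 yp2 x by linarith
  have "\<bar>eval2 (1, b, - 1) x y\<bar> \<le> 1"
    using assms x y by (auto simp: poly_norm_le_iff add.commute)
  then have "(b * x) * y \<le> 1 - x\<^sup>2 + y\<^sup>2" by (simp add: eval2_def)
  also have "\<dots> \<le> (2 * y) * y" using xp2 yp2 x by (simp add: power2_eq_square)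
  finally have "b * x \<le> 2 * y" using y by simp
  moreover have "b * (1 - y) \<le> b * x" using b x_ge by simp
  ultimately have "b * (1 - y) \<le> 2 * y" by linarith
  then have "b * b + b * 3 \<le> 0" using b by (simp add: y_def field_simps)
  moreover have "b * b > 0" using b by simp
  ultimately show False using b by linarith
qed

text \<open>Once the diagonal coefficient is matched by the intermediate value theorem, the two
  polynomials differ only in the term \<open>x y\<close>, so their values at one point with \<open>x y > 0\<close> order
  the mixed coefficients. The contact point of the curve serves for this.\<close>

lemma antisymmetric_dominated:
  assumes "p > 2" "poly_norm p (a, b, - a) \<le> 1" "a \<ge> 0"
  obtains t where "0 \<le> t" "t \<le> 1" "a = diag_coeff p t (lp_cofactor p t)"
    "b \<le> mixed_coeff p t (lp_cofactor p t)"
proof -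
  have ev: "\<bar>eval2 (a, b, - a) x y\<bar> \<le> 1" if "\<bar>x\<bar> powr p + \<bar>y\<bar> powr p \<le> 1" for x y
    using assms(1,2) that by (simp add: poly_norm_le_iff)
  have "a \<le> 1" using ev[of 1 0] by (simp add: eval2_def)
  have "diag_coeff p 0 (lp_cofactor p 0) = - 1" "diag_coeff p 1 (lp_cofactor p 1) = 1"
    using assms(1) by (simp_all add: diag_coeff_def lp_cofactor_def)
  then obtain t where t: "0 \<le> t" "t \<le> 1" and a: "diag_coeff p t (lp_cofactor p t) = a"
    using IVT'[of "\<lambda>t. diag_coeff p t (lp_cofactor p t)" 0 a 1]
      continuous_on_coeffs(1)[OF assms(1)] \<open>a \<ge> 0\<close> \<open>a \<le> 1\<close> by auto
  define s where "s = lp_cofactor p t"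
  have s: "s \<ge> 0" "t powr p + s powr p = 1"
    using lp_cofactor[of p t] assms(1) t by (auto simp: s_def)
  have "b \<le> mixed_coeff p t s"
  proof (cases "s = 0")
    case True
    then have "t powr p = 1" using s by simp
    then have "t = 1" using t assms(1) powr_less_mono2[of p t 1] by fastforce
    moreover have "a = diag_coeff p t 0" using a True by (simp add: s_def)
    ultimately have "a = 1" by (simp add: diag_coeff_def)
    then show ?thesis
      using mixed_coeff_nonpos_of_diag_one assms True by (simp add: mixed_coeff_def)
  next
    case False
    have "t \<noteq> 0"
    proof
      assume "t = 0"
      then have "a = - 1" using a assms(1) by (simp add: diag_coeff_def lp_cofactor_def)
      with \<open>a \<ge> 0\<close> show False by simp
    qed
    then have ts: "t * s > 0" using t s False by simp
    have "eval2 (a, b, - a) t s \<le> eval2 (a, mixed_coeff p t s, - a) t s"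
      using ev[of t s] extremal_eq_one[of t s p] s t a
      by (simp add: extremal_poly_def s_def[symmetric])
    then have "b * (t * s) \<le> mixed_coeff p t s * (t * s)"
      by (simp add: eval2_def mult.assoc)
    then show ?thesis using ts by (rule mult_right_le_imp_le)
  qed
  then show ?thesis using that t a s_def by auto
qed

lemma coeff_norm_dominated:
  assumes "q > 0" "p > 2" "poly_norm p P \<le> 1"
  obtains t where "0 \<le> t" "t \<le> 1" "coeff_norm q P \<le> f_qp q p t"
proof -
  obtain a b c where P: "P = (a, b, c)" by (cases P)
  define m where "m = max \<bar>a\<bar> \<bar>c\<bar>"
  have m: "\<bar>a\<bar> \<le> m" "\<bar>c\<bar> \<le> m" "m \<ge> 0" by (auto simp: m_def)
  have "poly_norm p (m, \<bar>b\<bar>, - m) \<le> 1"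
    using poly_norm_antisymmetrize_le[of p a b c 1] assms by (simp add: P m_def)
  then obtain t where t: "0 \<le> t" "t \<le> 1" "m = diag_coeff p t (lp_cofactor p t)"
    "\<bar>b\<bar> \<le> mixed_coeff p t (lp_cofactor p t)"
    using antisymmetric_dominated assms(2) m(3) by blast
  have "coeff_norm q P \<le> coeff_norm q (extremal_poly p t (lp_cofactor p t))"
    unfolding P extremal_poly_def using assms(1) m t by (intro coeff_norm_mono) auto
  then show ?thesis using that t f_qp_eq_coeff_norm[OF assms(2)] by simp
qed

theorem theorem3p3:
  fixes q p :: real
  assumes "q \<ge> 1" and "p > 2"
  shows "\<exists>t\<^sub>0\<in>{0..1}. (\<forall>t\<in>{0..1}. f_qp q p t \<le> f_qp q p t\<^sub>0) \<and> K2 q p = f_qp q p t\<^sub>0"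
proof -
  have q: "q > 0" and p: "p > 0" using assms by auto
  obtain t\<^sub>0 where t0: "t\<^sub>0 \<in> {0..1}" and max: "\<And>t. t \<in> {0..1} \<Longrightarrow> f_qp q p t \<le> f_qp q p t\<^sub>0"
    using f_qp_attains_max[OF q assms(2)] by blast
  define M where "M = f_qp q p t\<^sub>0"
  have "0 < f_qp q p 0" using assms by (simp add: f_qp_def)
  also have "\<dots> \<le> M" unfolding M_def by (intro max) simp
  finally have M: "M > 0" .
  have upper: "coeff_norm q P \<le> M * poly_norm p P" for P
  proof -
    obtain a b c where P: "P = (a, b, c)" by (cases P)
    \<comment> \<open>Normalizing by every \<open>N > poly_norm p P\<close> avoids dividing by a norm that may be 0.\<close>
    have "coeff_norm q P / M \<le> N" if N: "poly_norm p P < N" for N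
    proof -
      have "\<bar>eval2 P 0 0\<bar> \<le> poly_norm p P"
        using poly_norm_le_iff[OF p, of P "poly_norm p P"] by simp
      then have "N > 0" using N by linarith
      have "poly_norm p (a / N, b / N, c / N) \<le> 1"
        using poly_norm_scale_le[OF p \<open>N > 0\<close>] N by (simp add: P)
      then obtain t where "0 \<le> t" "t \<le> 1" "coeff_norm q (a / N, b / N, c / N) \<le> f_qp q p t"
        using coeff_norm_dominated[OF q assms(2)] by blast
      then have "coeff_norm q P / N \<le> M"
        using max[of t] coeff_norm_scale[OF q \<open>N > 0\<close>] by (simp add: P M_def)
      then show ?thesis using M \<open>N > 0\<close> by (simp add: field_simps)
    qed
    then have "coeff_norm q P / M \<le> poly_norm p P" by (rule dense_ge)
    then show ?thesis using M by (simp add: field_simps)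
  qed
  have lower: "M \<le> K" if "K > 0" and K: "\<forall>P. coeff_norm q P \<le> K * poly_norm p P" for K
  proof -
    define s where "s = lp_cofactor p t\<^sub>0"
    have "poly_norm p (extremal_poly p t\<^sub>0 s) \<le> 1"
      using lp_cofactor[OF p, of t\<^sub>0] t0 assms(2) unfolding s_def
      by (intro poly_norm_extremal_le) auto
    then have "K * poly_norm p (extremal_poly p t\<^sub>0 s) \<le> K"
      using \<open>K > 0\<close> by (simp add: mult_left_le)
    then have "coeff_norm q (extremal_poly p t\<^sub>0 s) \<le> K"
      using K order_trans by blast
    then show ?thesis
      using f_qp_eq_coeff_norm[OF assms(2), of t\<^sub>0 q] t0 by (simp add: M_def s_def)
  qed
  have "K2 q p = M"
    unfolding K2_def using M upper lower by (intro Least_equality) auto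
  then show ?thesis using t0 max M_def by blast
qed

end
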